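(* Let $m\ge 1$ be an integer, let $z_0,\dots,z_m\in\mathbb{C}$ be pairwise distinct, let $f_0,\dots,f_m\in\mathbb{C}$, and let $w_0,\dots,w_m\in\mathbb{C}$ all be nonzero. Let $$r(z)=\frac{\sum_{j=0}^m \frac{w_jf_j}{z-z_j}}{\sum_{j=0}^m\frac{w_j}{z-z_j}},\qquad r_j(z)=\frac{\frac{w_j}{z-z_j}}{\sum_{i=0}^m\frac{w_i}{z-z_i}}\quad (j=0,\dots,m).$$ Let $Z_m=\mathrm{diag}(z_0,z_1,\dots,z_m)$, let $\mathbf{f}_m=[f_0,f_1,\dots,f_m]^T$, and let $\underline{W_m}\in\mathbb{C}^{(m+1)\times m}$ be the lower bidiagonal matrix whose $j$-th column ($j=1,\dots,m$) has entry $-w_j$ in row $j$, entry $w_{j-1}$ in row $j+1$, and zeros elsewhere (rows numbered $1,\dots,m+1$). Let $Q\in\mathbb{C}^{(m+1)\times(m+1)}$ be any invertible matrix whose first column is $[1,1,\dots,1]^T$, and define rational functions $\widehat r_0,\dots,\widehat r_m$ by $$[\widehat r_0(z),\widehat r_1(z),\dots,\widehat r_m(z)]=[r_0(z),r_1(z),\dots,r_m(z)]\,Q.$$ Then, as identities of rational functions in $z$, $\widehat r_0\equiv 1$, $$z\,[\widehat r_0(z),\dots,\widehat r_m(z)]\,(Q^{-1}\underline{W_m})=[\widehat r_0(z),\dots,\widehat r_m(z)]\,(Q^{-1}Z_m\underline{W_m}),$$ and $$r(z)=[\widehat r_0(z),\dots,\widehat r_m(z)]\,(Q^{-1}\mathb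f{f}_m).$$
   Context: All identities are identities of rational functions of the complex variable $z$. *)

theory Defs
  imports
    "HOL-Computational_Algebra.Polynomial_Factorial"
    Jordan_Normal_Form.Gauss_Jordan_Elimination
    Complex_Main
begin

type_synonym ratfun = "complex poly fract"

definition cst :: "complex \<Rightarrow> ratfun" where
  "cst c = to_fract [:c:]"

definition indet :: ratfun where
  "indet = to_fract [:0, 1:]"

(* In the next two definitions the divisor is a nonzero element of the field of rational
   functions whenever the nodes z 0, ..., z m are distinct and the weights are nonzero. *)

definition bary :: "nat \<Rightarrow> (nat \<Rightarrow> complex) \<Rightarrow> (nat \<Rightarrow> complex) \<Rightarrow> (nat \<Rightarrow> complex) \<Rightarrow> ratfun" where
  "bary m z f w =
     (\<Sum>j = 0..m. (cst (w j) * cst (f j)) / (indet - cst (z j))) /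
     (\<Sum>j = 0..m. cst (w j) / (indet - cst (z j)))"

definition bary_basis :: "nat \<Rightarrow> (nat \<Rightarrow> complex) \<Rightarrow> (nat \<Rightarrow> complex) \<Rightarrow> nat \<Rightarrow> ratfun" where
  "bary_basis m z w j =
     (cst (w j) / (indet - cst (z j))) /
     (\<Sum>i = 0..m. cst (w i) / (indet - cst (z i)))"

(* Matrix indices start at 0, so column k here is column k + 1 in one-based numbering:
   entry - w (k + 1) in row k and entry w k in row k + 1. *)
definition weight_mat :: "nat \<Rightarrow> (nat \<Rightarrow> complex) \<Rightarrow> complex mat" where
  "weight_mat m w = mat (m + 1) m
     (\<lambda>(i, k). if i = k then - w (k + 1) else if i = k + 1 then w k else 0)"

(* The library inverse is option-valued; it is Some for every invertible square matrix. *)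
definition matinv :: "complex mat \<Rightarrow> complex mat" where
  "matinv Q = the (mat_inverse Q)"

end

(* Put D = sum_i w_i / (z - z_i), which is a nonzero rational function. Then r_j D (z - z_j) = w_j, so in each
   column of the bidiagonal matrix the two nonzero contributions to [r_0, ..., r_m] (z I - Z_m) W_m
   are w_{j-1} w_j / D and its negative. Passing to [r_0, ..., r_m] Q only inserts Q Q^{-1}. *)
theory Submission
  imports Defs
begin

lemma comm_ring_hom_cst: "comm_ring_hom cst"
  by unfold_locales (simp_all add: cst_def flip: to_fract_add to_fract_mult one_pCons)

text \<open>Homomorphism facts such as \<open>cst.mat_hom_mult\<close> let products of constant
  matrices be formed over the complex numbers and then embedded entrywise.\<close>

interpretation cst: comm_ring_hom cst
  by (fact comm_ring_hom_cst)

lemma indet_minus_cst: "indet - cst c = to_fract [:- c, 1:]"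
  by (simp add: indet_def cst_def flip: to_fract_diff)

lemma indet_minus_cst_nonzero: "indet - cst c \<noteq> 0"
  by (simp add: indet_minus_cst)

lemma to_fract_prod: "to_fract (prod p A) = (\<Prod>x\<in>A. to_fract (p x))"
  by (induction A rule: infinite_finite_induct) simp_all

text \<open>Clearing denominators turns the sum into a polynomial \<open>p\<close>. If the sum were
  zero, \<open>p\<close> would be zero too, but its value at \<open>z k\<close> is
  \<open>w k\<close> times differences of distinct nodes.\<close>

lemma sum_simple_fractions_nonzero:
  assumes "finite A" and "k \<in> A" and "inj_on z A" and "w k \<noteq> 0"
  shows "(\<Sum>j\<in>A. cst (w j) / (indet - cst (z j))) \<noteq> 0"
proof
  assume zero: "(\<Sum>j\<in>A. cst (w j) / (indet - cst (z j))) = 0"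
  define p where "p = (\<Sum>j\<in>A. [:w j:] * (\<Prod>i\<in>A - {j}. [:- z i, 1:]))"
  have "to_fract p = (\<Sum>j\<in>A. cst (w j) * (\<Prod>i\<in>A - {j}. indet - cst (z i)))"
    unfolding p_def to_fract_sum to_fract_mult to_fract_prod indet_minus_cst unfolding cst_def ..
  also have "\<dots> = (\<Sum>j\<in>A. cst (w j) / (indet - cst (z j)) * (\<Prod>i\<in>A. indet - cst (z i)))"
  proof (rule sum.cong[OF refl])
    fix j assume "j \<in> A"
    then show "cst (w j) * (\<Prod>i\<in>A - {j}. indet - cst (z i))
        = cst (w j) / (indet - cst (z j)) * (\<Prod>i\<in>A. indet - cst (z i))"
      using indet_minus_cst_nonzero[of "z j"]
      by (simp add: prod.remove[OF assms(1) \<open>j \<in> A\<close>])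
  qed
  also have "\<dots> = 0"
    unfolding sum_distrib_right[symmetric] zero by simp
  finally have "p = 0"
    by simp
  moreover have "poly p (z k) = w k * (\<Prod>i\<in>A - {k}. z k - z i)"
  proof -
    have "poly p (z k) = (\<Sum>j\<in>A. w j * (\<Prod>i\<in>A - {j}. z k - z i))"
      by (simp add: p_def poly_sum poly_prod)
    also have "\<dots> = (\<Sum>j\<in>{k}. w j * (\<Prod>i\<in>A - {j}. z k - z i))"
      \<comment> \<open>For j other than k, the product over \<open>A - {j}\<close> still contains
        the factor \<open>z k - z k\<close>.\<close>
      using assms(1,2) by (intro sum.mono_neutral_right) auto
    finally show ?thesis
      by simp
  qed
  moreover have "(\<Prod>i\<in>A - {k}. z k - z i) \<noteq> 0"
    using assms by (auto simp: inj_on_eq_iff)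
  ultimately show False
    using assms(4) by simp
qed

lemma matinv_right_inverse:
  assumes Q: "Q \<in> carrier_mat n n" and "invertible_mat Q"
  shows "matinv Q \<in> carrier_mat n n" and "Q * matinv Q = 1\<^sub>m n"
proof -
  obtain B where B: "Q * B = 1\<^sub>m (dim_row Q)" "B * Q = 1\<^sub>m (dim_row B)"
    using assms(2) unfolding invertible_mat_def inverts_mat_def by blast
  \<comment> \<open>\<open>invertible_mat\<close> does not fix the size of \<open>B\<close>: the
    column count of the first identity gives its width, that of the second its height.\<close>
  have "B \<in> carrier_mat n n"
    using Q arg_cong[OF B(1), of dim_col] arg_cong[OF B(2), of dim_col] by auto
  \<comment> \<open>\<open>mat_inverse\<close> returns \<open>None\<close> only outside this group
    of units, so \<open>the\<close> in \<open>matinv\<close> is applied to a genuine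
    inverse.\<close>
  then have "Q \<in> Units (ring_mat TYPE(complex) n ())"
    using B Q unfolding Units_def ring_mat_def by auto
  then obtain C where "mat_inverse Q = Some C"
    using mat_inverse(1)[OF Q, of "()"] by (cases "mat_inverse Q") auto
  then show "matinv Q \<in> carrier_mat n n" "Q * matinv Q = 1\<^sub>m n"
    using mat_inverse(2)[OF Q, of C] by (auto simp: matinv_def)
qed

text \<open>Reassociating brings the embedded \<open>Q\<close> next to the embedded product. Both
  come from complex matrices, so the cancellation takes place before embedding.\<close>

lemma row_mult_matinv_cancel:
  assumes Q: "Q \<in> carrier_mat n n" "invertible_mat Q"
    and B: "B \<in> carrier_mat k n" and A: "A \<in> carrier_mat n l"
  shows "B * map_mat cst Q * map_mat cst (matinv Q * A) = B * map_mat cst A"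
proof -
  note inv = matinv_right_inverse[OF Q]
  have "B * map_mat cst Q * map_mat cst (matinv Q * A) = B * (map_mat cst Q * map_mat cst (matinv Q * A))"
    using Q A B inv by (intro assoc_mult_mat[of _ k n _ n _ l]) auto
  also have "map_mat cst Q * map_mat cst (matinv Q * A) = map_mat cst (Q * (matinv Q * A))"
    using Q A inv by (intro cst.mat_hom_mult[symmetric]) auto
  also have "Q * (matinv Q * A) = A"
    using Q A inv by (simp flip: assoc_mult_mat)
  finally show ?thesis .
qed

lemma row_mult_matinv_vec_cancel:
  assumes Q: "Q \<in> carrier_mat n n" "invertible_mat Q"
    and B: "B \<in> carrier_mat k n" and v: "v \<in> carrier_vec n"
  shows "B * map_mat cst Q *\<^sub>v map_vec cst (matinv Q *\<^sub>v v) = B *\<^sub>v map_vec cst v"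
proof -
  note inv = matinv_right_inverse[OF Q]
  have "B * map_mat cst Q *\<^sub>v map_vec cst (matinv Q *\<^sub>v v) = B *\<^sub>v (map_mat cst Q *\<^sub>v map_vec cst (matinv Q *\<^sub>v v))"
    using Q v B inv by (intro assoc_mult_mat_vec[of _ k n _ n]) auto
  also have "map_mat cst Q *\<^sub>v map_vec cst (matinv Q *\<^sub>v v) = map_vec cst (Q *\<^sub>v (matinv Q *\<^sub>v v))"
    using Q v inv by (intro cst.mult_mat_vec_hom[symmetric]) auto
  also have "Q *\<^sub>v (matinv Q *\<^sub>v v) = v"
    using Q v inv by (simp flip: assoc_mult_mat_vec)
  finally show ?thesis .
qed

lemma weight_mat_carrier: "weight_mat m w \<in> carrier_mat (m + 1) m"
  by (simp add: weight_mat_def)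

lemma bary_basis_weight_column:
  assumes "k < m"
  shows "(\<Sum>i<m + 1. bary_basis m z w i * (indet - cst (z i)) * cst (weight_mat m w $$ (i, k))) = 0"
proof -
  let ?D = "\<Sum>i = 0..m. cst (w i) / (indet - cst (z i))"
  \<comment> \<open>Only the nonzero factor \<open>indet - cst (z i)\<close> is cancelled; were
    \<open>?D\<close> zero, both sides would be 0 by the convention x / 0 = 0.\<close>
  have basis: "bary_basis m z w i * (indet - cst (z i)) = cst (w i) / ?D" for i
    unfolding bary_basis_def using indet_minus_cst_nonzero[of "z i"] by simp
  have "(\<Sum>i<m + 1. cst (w i) / ?D * cst (weight_mat m w $$ (i, k)))
      = (\<Sum>i\<in>{k, k + 1}. cst (w i) / ?D * cst (weight_mat m w $$ (i, k)))"
    using assms by (intro sum.mono_neutral_right) (auto simp: weight_mat_def)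
  also have "\<dots> = 0"
    using assms by (simp add: weight_mat_def cst.hom_uminus)
  finally show ?thesis
    by (simp only: basis)
qed

lemma bary_basis_pencil:
  fixes m z w
  defines "B \<equiv> mat_of_row (vec (m + 1) (bary_basis m z w))"
  shows "indet \<cdot>\<^sub>m (B * map_mat cst (weight_mat m w)) = B * map_mat cst (mat_diag (m + 1) z * weight_mat m w)"
proof (rule eq_matI)
  fix i k
  assume "i < dim_row (B * map_mat cst (mat_diag (m + 1) z * weight_mat m w))"
    and "k < dim_col (B * map_mat cst (mat_diag (m + 1) z * weight_mat m w))"
  then have ik: "i = 0" "k < m"
    using weight_mat_carrier[of m w] by (auto simp: B_def)
  let ?b = "bary_basis m z w" and ?W = "weight_mat m w"
  have ZW: "mat_diag (m + 1) z * ?W = mat (m + 1) m (\<lambda>(i, k). z i * ?W $$ (i, k))"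
    by (rule mat_diag_mult_left[OF weight_mat_carrier])
  \<comment> \<open>Left multiplication by the diagonal matrix scales row i by \<open>z i\<close>,
    so the difference of the two sides collects the factors
    \<open>indet - cst (z i)\<close>.\<close>
  have "(indet \<cdot>\<^sub>m (B * map_mat cst ?W)) $$ (0, k) - (B * map_mat cst (mat_diag (m + 1) z * ?W)) $$ (0, k)
      = indet * (\<Sum>i<m + 1. ?b i * cst (?W $$ (i, k))) - (\<Sum>i<m + 1. ?b i * cst (z i * ?W $$ (i, k)))"
    unfolding ZW using ik weight_mat_carrier[of m w]
    by (simp add: B_def scalar_prod_def atLeast0LessThan del: sum.lessThan_Suc)
  also have "\<dots> = (\<Sum>i<m + 1. ?b i * (indet - cst (z i)) * cst (?W $$ (i, k)))"
    unfolding sum_distrib_left sum_subtractf[symmetric]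
    by (intro sum.cong refl) (simp add: cst.hom_mult algebra_simps)
  also have "\<dots> = 0"
    by (rule bary_basis_weight_column[OF ik(2)])
  finally show "(indet \<cdot>\<^sub>m (B * map_mat cst ?W)) $$ (i, k) = (B * map_mat cst (mat_diag (m + 1) z * ?W)) $$ (i, k)"
    using ik by simp
qed (use weight_mat_carrier[of m w] in \<open>auto simp: B_def\<close>)

lemma bary_eq_sum_basis: "bary m z f w = (\<Sum>j<m + 1. bary_basis m z w j * cst (f j))"
  unfolding bary_def bary_basis_def sum_divide_distrib
  by (intro sum.cong) auto

text \<open>The sum is the common denominator divided by itself; distinct nodes and nonzero weights
  ensure that this is not 0 / 0.\<close>

lemma sum_bary_basis:
  assumes "inj_on z {0..m}" and "\<forall>j\<in>{0..m}. w j \<noteq> 0"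
  shows "(\<Sum>j<m + 1. bary_basis m z w j) = 1"
proof -
  have "(\<Sum>j = 0..m. cst (w j) / (indet - cst (z j))) \<noteq> 0"
    using assms by (intro sum_simple_fractions_nonzero[of _ 0]) auto
  moreover have "{..<m + 1} = {0..m}"
    by auto
  ultimately show ?thesis
    by (simp add: bary_basis_def flip: sum_divide_distrib del: sum.lessThan_Suc divide_divide_eq_left divide_divide_eq_right)
qed

theorem mainTheorem2:
  fixes m :: nat
    and z f w :: "nat \<Rightarrow> complex"
    and Q :: "complex mat"
    and rhat :: "ratfun vec"
  assumes "m \<ge> 1"
    and "inj_on z {0..m}"
    and "\<forall>j\<in>{0..m}. w j \<noteq> 0"
    and "Q \<in> carrier_mat (m + 1) (m + 1)"
    and "invertible_mat Q"
    and "col Q 0 = vec (m + 1) (\<lambda>_. 1)"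
    and "mat_of_row rhat = mat_of_row (vec (m + 1) (bary_basis m z w)) * map_mat cst Q"
  shows "rhat $ 0 = 1
    \<and> indet \<cdot>\<^sub>m (mat_of_row rhat * map_mat cst (matinv Q * weight_mat m w))
        = mat_of_row rhat * map_mat cst (matinv Q * (mat_diag (m + 1) z * weight_mat m w))
    \<and> bary m z f w = rhat \<bullet> map_vec cst (matinv Q *\<^sub>v vec (m + 1) f)"
proof (intro conjI)
  let ?b = "vec (m + 1) (bary_basis m z w)"
  note Q = assms(4,5) and rhat = assms(7)
  have b: "mat_of_row ?b \<in> carrier_mat 1 (m + 1)"
    by (intro mat_of_row_carrier) simp
  \<comment> \<open>The length of \<open>rhat\<close> is read off from the width of the product that
    defines it.\<close>
  have dim: "dim_vec rhat = m + 1"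
    using arg_cong[OF rhat, of dim_col] Q by simp
  have col0: "Q $$ (i, 0) = 1" if "i < m + 1" for i
    using arg_cong[OF assms(6), of "\<lambda>v. v $ i"] that Q by simp
  have "rhat $ 0 = mat_of_row rhat $$ (0, 0)"
    using dim by simp
  also have "\<dots> = (\<Sum>i<m + 1. bary_basis m z w i * cst (Q $$ (i, 0)))"
    unfolding rhat using Q
    by (simp add: scalar_prod_def atLeast0LessThan del: sum.lessThan_Suc)
  also have "\<dots> = (\<Sum>i<m + 1. bary_basis m z w i)"
    by (intro sum.cong) (auto simp: col0)
  also have "\<dots> = 1"
    by (rule sum_bary_basis[OF assms(2,3)])
  finally show "rhat $ 0 = 1" .
  have ZW: "mat_diag (m + 1) z * weight_mat m w \<in> carrier_mat (m + 1) m"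
    by (intro mult_carrier_mat[OF mat_diag_dim weight_mat_carrier])
  show "indet \<cdot>\<^sub>m (mat_of_row rhat * map_mat cst (matinv Q * weight_mat m w))
      = mat_of_row rhat * map_mat cst (matinv Q * (mat_diag (m + 1) z * weight_mat m w))"
    \<comment> \<open>Cancelling \<open>Q\<close> against \<open>matinv Q\<close> on both sides
      leaves the relation for the original basis.\<close>
    unfolding rhat row_mult_matinv_cancel[OF Q b weight_mat_carrier] row_mult_matinv_cancel[OF Q b ZW]
    by (rule bary_basis_pencil)
  \<comment> \<open>The scalar product is the single entry of a one-row matrix times a vector, the
    form in which \<open>Q\<close> can be cancelled.\<close>
  have "rhat \<bullet> map_vec cst (matinv Q *\<^sub>v vec (m + 1) f)
      = (mat_of_row rhat *\<^sub>v map_vec cst (matinv Q *\<^sub>v vec (m + 1) f)) $ 0"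
    by simp
  also have "\<dots> = (mat_of_row ?b *\<^sub>v map_vec cst (vec (m + 1) f)) $ 0"
    unfolding rhat by (subst row_mult_matinv_vec_cancel[OF Q b]) auto
  also have "\<dots> = bary m z f w"
    by (simp add: bary_eq_sum_basis scalar_prod_def atLeast0LessThan del: sum.lessThan_Suc)
  finally show "bary m z f w = rhat \<bullet> map_vec cst (matinv Q *\<^sub>v vec (m + 1) f)" ..
qed

end
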